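(* Let $k,\ell,m,n$ be positive integers, let $H \in \mathrm{But}(n,k)$ and $M \in \mathrm{But}(m,\ell)$. Define a map $\phi$ on $G_k=\langle \zeta_k\rangle$ by $\phi(\zeta_k^{i}) = \sqrt{m}^{\,1-i} M^{i}$, and write $H^{\phi}$ for the $mn\times mn$ matrix obtained by replacing each entry $h$ of $H$ by the $m\times m$ block $\phi(h)$. If $(H,M)$ is a sound pair, then $H^{\phi} \in \mathrm{But}(mn,\ell)$.
   Context: $\zeta_k = e^{2\pi i/k}$ and $G_k=\langle\zeta_k\rangle$. For an $n\times n$ complex matrix $H$ we write $H^\ast$ for its conjugate transpose. $\mathrm{But}(n,k)$ denotes the set of $n\times n$ matrices $H$ with all entries in $G_k$ satisfying $HH^{\ast}=nI_n$ (Butson Hadamard matrices). For $H$ with entries in $G_k$ and an integer $r$, $H^{(r)}$ denotes the matrix obtained by replacing each entry by its $r$-th power. Sound pair: let $X,Y\subseteq G_k$. For $H\in\mathrm{But}(n,k)$ with every entry in $X$ and $M\in\mathrm{But}(m,\ell)$ with every eigenvalue of $\sqrt{m}^{-1}M$ in $Y$, the pair $(H,M)$ is $(X,Y)$-sound if (1) for each $\zeta_k^{i}\in X$, $\sqrt{m}^{\,1-i}M^{i}\in\mathrm{But}(m,\ell)$, and (2) for each $\zeta_k^{j}\in Y$, $H^{(j)}\in\mathrm{But}(n,k)$. The pair $(H,M)$ is called sound if it is $(X,Y)$-sound for some $X,Y\subseteq G_k$. *)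

theory Defs
  imports
    Complex_Main
    "Jordan_Normal_Form.Schur_Decomposition"
    "Jordan_Normal_Form.Gauss_Jordan_Elimination"
begin

definition \<zeta> :: "nat \<Rightarrow> complex" where
  "\<zeta> k = exp (2 * of_real pi * \<i> / of_nat k)"

definition G :: "nat \<Rightarrow> complex set" where
  "G k = {\<zeta> k powi i | i :: int. True}"

(* On complex matrices, mat_adjoint is the conjugate transpose. *)
definition But :: "nat \<Rightarrow> nat \<Rightarrow> complex mat set" where
  "But n k = {H \<in> carrier_mat n n.
     elements_mat H \<subseteq> G k \<and> H * mat_adjoint H = of_nat n \<cdot>\<^sub>m 1\<^sub>m n}"

definition entrywise_power :: "complex mat \<Rightarrow> int \<Rightarrow> complex mat" where
  "entrywise_power H r = map_mat (\<lambda>z. z powi r) H"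

(* Only meant for invertible square matrices; mat_inverse returns Some of the
   inverse of such a matrix.  A member of But m l with m > 0 is invertible. *)
definition mat_powi :: "'a :: field mat \<Rightarrow> int \<Rightarrow> 'a mat" where
  "mat_powi A i =
     (if 0 \<le> i then A ^\<^sub>m nat i else the (mat_inverse A) ^\<^sub>m nat (- i))"

definition scaled_power :: "nat \<Rightarrow> complex mat \<Rightarrow> int \<Rightarrow> complex mat" where
  "scaled_power m M i = (complex_of_real (sqrt (real m)) powi (1 - i)) \<cdot>\<^sub>m mat_powi M i"

definition XY_sound ::
  "nat \<Rightarrow> nat \<Rightarrow> nat \<Rightarrow> nat \<Rightarrow> complex set \<Rightarrow> complex set \<Rightarrow> complex mat \<Rightarrow> complex mat \<Rightarrow> bool"
where
  "XY_sound n k m l X Y H M \<longleftrightarrow>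
     X \<subseteq> G k \<and> Y \<subseteq> G k \<and>
     H \<in> But n k \<and> elements_mat H \<subseteq> X \<and>
     M \<in> But m l \<and>
     (\<forall>e. eigenvalue (inverse (complex_of_real (sqrt (real m))) \<cdot>\<^sub>m M) e \<longrightarrow> e \<in> Y) \<and>
     (\<forall>i :: int. \<zeta> k powi i \<in> X \<longrightarrow> scaled_power m M i \<in> But m l) \<and>
     (\<forall>j :: int. \<zeta> k powi j \<in> Y \<longrightarrow> entrywise_power H j \<in> But n k)"

definition sound ::
  "nat \<Rightarrow> nat \<Rightarrow> nat \<Rightarrow> nat \<Rightarrow> complex mat \<Rightarrow> complex mat \<Rightarrow> bool"
where
  "sound n k m l H M \<longleftrightarrow> (\<exists>X Y. X \<subseteq> G k \<and> Y \<subseteq> G k \<and> XY_sound n k m l X Y H M)"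

(* The exponent i is determined by h only modulo k, and phi picks one.
   Independence of the choice is not automatic: it amounts to the k-th power of
   M / sqrt m being the identity, which uses the eigenvalue condition of a sound pair. *)
definition phi :: "nat \<Rightarrow> nat \<Rightarrow> complex mat \<Rightarrow> complex \<Rightarrow> complex mat" where
  "phi k m M h = scaled_power m M (SOME i :: int. h = \<zeta> k powi i)"

definition block_subst :: "nat \<Rightarrow> (complex \<Rightarrow> complex mat) \<Rightarrow> complex mat \<Rightarrow> complex mat" where
  "block_subst m f H = mat (dim_row H * m) (dim_col H * m)
     (\<lambda>(i, j). f (H $$ (i div m, j div m)) $$ (i mod m, j mod m))"

end

theory Submission
  imports
    Defs
    "Jordan_Normal_Form.Jordan_Normal_Form_Existence"
    "Jordan_Normal_Form.Jordan_Normal_Form_Uniqueness"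
begin

text \<open>
  Since \<open>M\<close> is normal, \<open>M = \<surd>m P D Q\<close> with \<open>Q\<close> inverse to \<open>P\<close> and \<open>D = diag(z\<^sub>r)\<close>, where
  soundness makes every \<open>z\<^sub>r\<close> a power of \<open>\<zeta>\<close>. Hence the image \<open>\<surd>m P D^i Q\<close> of \<open>\<zeta>^i\<close> under
  \<open>phi\<close> depends on \<open>\<zeta>^i\<close> only, and condition (1) gives its adjoint as \<open>\<surd>m P D^(-i) Q\<close>.
  With \<open>B\<close> the substituted matrix, the \<open>(a, b)\<close> block of \<open>B B*\<close> is therefore
  \<open>m P diag(t\<^sub>r) Q\<close>, where for \<open>z\<^sub>r = \<zeta>^j\<close> the number \<open>t\<^sub>r\<close> is the \<open>(a, b)\<close> entry of
  \<open>K K*\<close> for \<open>K\<close> the entrywise \<open>j\<close>-th power of \<open>H\<close>. By condition (2) it is \<open>n\<close> if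
  \<open>a = b\<close> and \<open>0\<close> otherwise.
\<close>

section \<open>Adjoints and the diagonalization of normal matrices\<close>

lemma dim_mat_adjoint [simp]:
  "dim_row (mat_adjoint A) = dim_col A" "dim_col (mat_adjoint A) = dim_row A"
  by (simp_all add: mat_adjoint_def)

lemma mat_adjoint_carrier [simp]:
  "A \<in> carrier_mat n m \<Longrightarrow> mat_adjoint A \<in> carrier_mat m n"
  by (intro carrier_matI) auto

lemma mat_adjoint_index [simp]:
  "i < dim_col A \<Longrightarrow> j < dim_row A \<Longrightarrow> mat_adjoint A $$ (i, j) = conjugate (A $$ (j, i))"
  by (simp add: mat_adjoint_def mat_of_rows_def)

lemma scalar_prod_mult_mat_vec_adjoint:
  fixes A :: "'a :: conjugatable_field mat"
  assumes "A \<in> carrier_mat n m" "v \<in> carrier_vec m" "w \<in> carrier_vec n"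
  shows "(A *\<^sub>v v) \<bullet>c w = v \<bullet>c (mat_adjoint A *\<^sub>v w)"
proof -
  have "(A *\<^sub>v v) \<bullet>c w = (\<Sum>i<n. \<Sum>j<m. A $$ (i, j) * v $ j * conjugate (w $ i))"
    using assms by (auto simp: scalar_prod_def sum_distrib_right atLeast0LessThan intro!: sum.cong)
  also have "\<dots> = (\<Sum>j<m. \<Sum>i<n. A $$ (i, j) * v $ j * conjugate (w $ i))"
    by (rule sum.swap)
  also have "\<dots> = v \<bullet>c (mat_adjoint A *\<^sub>v w)"
    using assms by (auto simp: scalar_prod_def sum_distrib_left atLeast0LessThan sum_conjugate
        conjugate_dist_mul mult_ac intro!: sum.cong)
  finally show ?thesis .
qed

text \<open>Let \<open>w = A v\<close> with \<open>A w = 0\<close>. As \<open>A\<close> commutes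
  with its adjoint, it also kills the image of \<open>w\<close> under the adjoint; adjointness makes
  the squared norm of that image \<open>0\<close>, and a second use of adjointness makes the squared
  norm of \<open>w\<close> equal to \<open>0\<close>.\<close>

lemma mat_kernel_normal_square:
  fixes A :: "complex mat"
  assumes A: "A \<in> carrier_mat n n" and normal: "A * mat_adjoint A = mat_adjoint A * A"
  shows "mat_kernel (A ^\<^sub>m 2) = mat_kernel A"
proof -
  have sq: "A ^\<^sub>m 2 = A * A" using A by (simp add: numeral_2_eq_2)
  let ?B = "mat_adjoint A"
  have B: "?B \<in> carrier_mat n n" using A by simp
  have "v \<in> mat_kernel A" if "v \<in> mat_kernel (A * A)" for v
  proof -
    have v: "v \<in> carrier_vec n" and z: "A * A *\<^sub>v v = 0\<^sub>v n"
      using mat_kernelD[OF mult_carrier_mat[OF A A] that] by auto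
    define w where "w = A *\<^sub>v v"
    have w: "w \<in> carrier_vec n" using A v by (simp add: w_def)
    have Aw: "A *\<^sub>v w = 0\<^sub>v n" using z A v by (simp add: w_def)
    have Bw: "?B *\<^sub>v w \<in> carrier_vec n" using B w by simp
    have "A *\<^sub>v (?B *\<^sub>v w) = ?B *\<^sub>v (A *\<^sub>v w)"
      using assoc_mult_mat_vec[OF A B w] assoc_mult_mat_vec[OF B A w] normal by simp
    also have "\<dots> = 0\<^sub>v n" unfolding Aw using B by (intro eq_vecI) (auto simp: scalar_prod_def)
    finally have "A *\<^sub>v (?B *\<^sub>v w) = 0\<^sub>v n" .
    then have "(?B *\<^sub>v w) \<bullet>c (?B *\<^sub>v w) = 0"
      using scalar_prod_mult_mat_vec_adjoint[OF A Bw w] w by simp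
    then have "?B *\<^sub>v w = 0\<^sub>v n" using Bw by simp
    then have "w \<bullet>c w = 0"
      using scalar_prod_mult_mat_vec_adjoint[OF A v w] v by (simp add: w_def)
    then have "w = 0\<^sub>v n" using w by simp
    then show ?thesis using A v by (auto simp: w_def intro: mat_kernelI)
  qed
  moreover have "mat_kernel A \<subseteq> mat_kernel (A * A)" by (rule mat_kernel_mult_subset[OF A A])
  ultimately show ?thesis unfolding sq by blast
qed

text \<open>The two products expand to the same terms once \<open>A\<close> commutes with its
  adjoint. This extends the kernel comparison from the eigenvalue 0 to every
  \<open>e\<close>.\<close>

lemma normal_char_matrix:
  fixes A :: "complex mat"
  assumes A: "A \<in> carrier_mat n n" and normal: "A * mat_adjoint A = mat_adjoint A * A"
  shows "char_matrix A e * mat_adjoint (char_matrix A e)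
    = mat_adjoint (char_matrix A e) * char_matrix A e"
proof -
  let ?B = "mat_adjoint A"
  let ?I = "1\<^sub>m n :: complex mat"
  have B: "?B \<in> carrier_mat n n" using A by simp
  have adj: "mat_adjoint (char_matrix A e) = ?B + (- cnj e) \<cdot>\<^sub>m ?I"
    using A by (intro eq_matI) (auto simp: char_matrix_def)
  have ch: "char_matrix A e = A + (- e) \<cdot>\<^sub>m ?I"
    using A by (simp add: char_matrix_def)
  have prod: "(X + a \<cdot>\<^sub>m ?I) * (Y + b \<cdot>\<^sub>m ?I) = X * Y + b \<cdot>\<^sub>m X + a \<cdot>\<^sub>m Y + (a * b) \<cdot>\<^sub>m ?I"
    if X: "X \<in> carrier_mat n n" and Y: "Y \<in> carrier_mat n n" for X Y a b
  proof -
    have "(X + a \<cdot>\<^sub>m ?I) * (Y + b \<cdot>\<^sub>m ?I)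
        = X * Y + X * (b \<cdot>\<^sub>m ?I) + ((a \<cdot>\<^sub>m ?I) * Y + (a \<cdot>\<^sub>m ?I) * (b \<cdot>\<^sub>m ?I))"
      using X Y by (subst add_mult_distrib_mat[of _ n n _ _ n])
        (auto simp: mult_add_distrib_mat[of _ n n _ n])
    also have "\<dots> = X * Y + b \<cdot>\<^sub>m X + (a \<cdot>\<^sub>m Y + (a * b) \<cdot>\<^sub>m ?I)"
      using X Y by (auto simp: mult_smult_distrib[of _ n n] mult_smult_assoc_mat[of _ n n]
         intro!: eq_matI)
    also have "\<dots> = X * Y + b \<cdot>\<^sub>m X + a \<cdot>\<^sub>m Y + (a * b) \<cdot>\<^sub>m ?I"
      using X Y by (intro eq_matI) auto
    finally show ?thesis .
  qed
  show ?thesis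
    unfolding adj unfolding ch prod[OF A B] prod[OF B A] normal
    using A B by (intro eq_matI) (auto simp: algebra_simps)
qed

lemma jordan_matrix_unit_blocks:
  assumes "\<forall>p \<in> set ps. fst p = 1"
  shows "jordan_matrix ps = mat_diag (length ps) (\<lambda>i. snd (ps ! i))"
  using assms
proof (induction ps)
  case Nil
  show ?case by (intro eq_matI) (auto simp: jordan_matrix_def mat_diag_def)
next
  case (Cons p ps)
  obtain a where p: "p = (1, a)" using Cons.prems by (cases p) auto
  have len: "sum_list (map fst ps) = length ps"
    using Cons.prems by (induction ps) auto
  have "jordan_matrix ps = mat_diag (length ps) (\<lambda>i. snd (ps ! i))"
    using Cons by simp
  then show ?case unfolding p jordan_matrix_Cons len
    by (intro eq_matI) (auto simp: mat_diag_def nth_Cons')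
qed

text \<open>Termwise \<open>min 1 \<le> min 2\<close>, so equal sums force termwise equality. It is
  meant for the sizes of the Jordan blocks of one eigenvalue.\<close>

lemma sum_list_min_eq_imp_le_one:
  assumes "sum_list (map (min 1) ns) = sum_list (map (min 2) ns)" "n \<in> set ns"
  shows "n \<le> (1::nat)"
  using assms
proof (induction ns)
  case (Cons m ns)
  have "sum_list (map (min 1) ns) \<le> sum_list (map (min 2) ns)"
    by (intro sum_list_mono) auto
  moreover have "min 1 m \<le> min 2 m" by simp
  ultimately have "min 1 m = min 2 m" "sum_list (map (min 1) ns) = sum_list (map (min 2) ns)"
    using Cons.prems(1) unfolding list.map sum_list.Cons by linarith+
  moreover from this(1) have "m \<le> 1" by linarith
  ultimately show ?case using Cons.IH Cons.prems(2) by auto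
qed simp

text \<open>
  For normal \<open>A\<close> the kernels of \<open>A - e\<close> and of its square agree, so no Jordan block has size 2 or more.
\<close>

lemma normal_similar_mat_diag:
  fixes A :: "complex mat"
  assumes A: "A \<in> carrier_mat n n" and normal: "A * mat_adjoint A = mat_adjoint A * A"
  obtains d P Q where "similar_mat_wit A (mat_diag n d) P Q"
proof -
  obtain as where "char_poly A = (\<Prod>a\<leftarrow>as. [:- a, 1:])"
    using char_poly_factorized[OF A] by blast
  then obtain ps where jnf: "jordan_nf A ps" using jordan_nf_exists[OF A] by blast
  have one: "fst p = 1" if p: "p \<in> set ps" for p
  proof -
    let ?C = "char_matrix A (snd p)"
    have C: "?C \<in> carrier_mat n n" using A by simp
    have "mat_kernel (?C ^\<^sub>m 2) = mat_kernel (?C ^\<^sub>m 1)"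
      using mat_kernel_normal_square[OF C normal_char_matrix[OF A normal]] C by simp
    moreover have "dim_col (?C ^\<^sub>m 2) = n" "dim_col (?C ^\<^sub>m 1) = n"
      using C pow_carrier_mat[OF C] by auto
    ultimately have "dim_gen_eigenspace A (snd p) 1 = dim_gen_eigenspace A (snd p) 2"
      by (simp add: dim_gen_eigenspace_def kernel_dim_def)
    \<comment> \<open>The dimension at exponent \<open>k\<close> is the sum of \<open>min k\<close>
      over the sizes of the blocks with eigenvalue \<open>snd p\<close>.\<close>
    then have "fst p \<le> 1"
      unfolding dim_gen_eigenspace[OF jnf]
      by (rule sum_list_min_eq_imp_le_one) (use p in force)
    moreover have "fst p \<noteq> 0" using jnf p by (auto simp: jordan_nf_def image_iff)
    ultimately show ?thesis by simp
  qed
  let ?D = "mat_diag (length ps) (\<lambda>i. snd (ps ! i))"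
  obtain P Q where wit: "similar_mat_wit A ?D P Q"
    using jnf jordan_matrix_unit_blocks[of ps] one by (auto simp: jordan_nf_def similar_mat_def)
  then have "?D \<in> carrier_mat n n" using similar_mat_witD2[OF A] by blast
  then have "length ps = n" using mat_diag_dim[of "length ps"] by (metis carrier_matD(1))
  with wit that show thesis by blast
qed


section \<open>Calculus of the matrices \<open>P * mat_diag n f * Q\<close> for mutually inverse
  \<open>P\<close> and \<open>Q\<close>\<close>

lemma mat_diag_power: "mat_diag n d ^\<^sub>m k = mat_diag n (\<lambda>i. (d i :: 'a :: comm_semiring_1) ^ k)"
proof (induction k)
  case 0
  show ?case by (simp add: carrier_matD(1)[OF mat_diag_dim])
next
  case (Suc k)
  then show ?case by (simp add: mult.commute)
qed

lemma smult_mat_diag: "c \<cdot>\<^sub>m mat_diag n d = mat_diag n (\<lambda>i. (c :: 'a :: comm_ring_1) * d i)"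
  by (intro eq_matI) (auto simp: mat_diag_def)

lemma mat_diag_cong: "(\<And>i. i < n \<Longrightarrow> f i = g i) \<Longrightarrow> mat_diag n f = mat_diag n g"
  by (intro eq_matI) (auto simp: mat_diag_def)

text \<open>The inner factor \<open>Q * P\<close> cancels, so products of such matrices reduce to
  pointwise products of their diagonals.\<close>

lemma similar_diag_mult:
  fixes P Q :: "'a :: comm_ring_1 mat"
  assumes P: "P \<in> carrier_mat n n" and Q: "Q \<in> carrier_mat n n" and QP: "Q * P = 1\<^sub>m n"
  shows "(P * mat_diag n f * Q) * (P * mat_diag n g * Q) = P * mat_diag n (\<lambda>i. f i * g i) * Q"
proof -
  let ?F = "mat_diag n f" and ?G = "mat_diag n g"
  have F: "?F \<in> carrier_mat n n" and G: "?G \<in> carrier_mat n n" by simp_all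
  have "(P * ?F * Q) * (P * ?G * Q) = P * ?F * (Q * (P * ?G * Q))"
    using P Q F G by (intro assoc_mult_mat[of _ n n _ n _ n]) auto
  also have "Q * (P * ?G * Q) = Q * (P * (?G * Q))"
    using P Q G by (simp add: assoc_mult_mat[OF P G Q])
  also have "\<dots> = (Q * P) * (?G * Q)"
    by (rule assoc_mult_mat[OF Q P mult_carrier_mat[OF G Q], symmetric])
  also have "\<dots> = ?G * Q" unfolding QP by (rule left_mult_one_mat[OF mult_carrier_mat[OF G Q]])
  also have "P * ?F * (?G * Q) = P * ?F * ?G * Q"
    by (rule assoc_mult_mat[OF mult_carrier_mat[OF P F] G Q, symmetric])
  also have "P * ?F * ?G = P * (?F * ?G)" by (rule assoc_mult_mat[OF P F G])
  finally show ?thesis by simp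
qed

lemma similar_diag_smult:
  fixes P Q :: "'a :: comm_ring_1 mat"
  assumes P: "P \<in> carrier_mat n n" and Q: "Q \<in> carrier_mat n n"
  shows "c \<cdot>\<^sub>m (P * mat_diag n f * Q) = P * mat_diag n (\<lambda>i. c * f i) * Q"
  unfolding smult_mat_diag[symmetric]
  using mult_smult_distrib[OF P mat_diag_dim, of c f]
    mult_smult_assoc_mat[OF mult_carrier_mat[OF P mat_diag_dim] Q, of c f]
  by simp

lemma similar_diag_const:
  fixes P Q :: "'a :: comm_ring_1 mat"
  assumes P: "P \<in> carrier_mat n n" and Q: "Q \<in> carrier_mat n n" and PQ: "P * Q = 1\<^sub>m n"
  shows "P * mat_diag n (\<lambda>i. c) * Q = c \<cdot>\<^sub>m 1\<^sub>m n"
  using similar_diag_smult[OF P Q, of c "\<lambda>i. 1"] P PQ by simp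

lemma similar_diag_index:
  fixes P Q :: "'a :: comm_ring_1 mat"
  assumes P: "P \<in> carrier_mat n n" and Q: "Q \<in> carrier_mat n n" and "i < n" "j < n"
  shows "(P * mat_diag n f * Q) $$ (i, j) = (\<Sum>r<n. P $$ (i, r) * f r * Q $$ (r, j))"
  using assms unfolding mat_diag_mult_right[OF P]
  by (simp add: scalar_prod_def atLeast0LessThan)

text \<open>Similar matrices share their characteristic polynomial, and a diagonal matrix has its
  diagonal entries as roots. This is how the eigenvalue condition of soundness reaches the diagonal
  form of \<open>M\<close>.\<close>

lemma eigenvalue_similar_diag:
  fixes A :: "'a :: field mat"
  assumes A: "A \<in> carrier_mat n n" and wit: "similar_mat_wit A (mat_diag n d) P Q" and j: "j < n"
  shows "eigenvalue A (d j)"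
proof -
  have "char_poly A = char_poly (mat_diag n d)"
    using wit by (intro char_poly_similar) (auto simp: similar_mat_def)
  also have "\<dots> = (\<Prod>a\<leftarrow>diag_mat (mat_diag n d). [:- a, 1:])"
    by (rule char_poly_upper_triangular[OF mat_diag_dim]) (auto simp: mat_diag_def)
  finally have cp: "char_poly A = (\<Prod>a\<leftarrow>diag_mat (mat_diag n d). [:- a, 1:])" .
  have "d j \<in> set (diag_mat (mat_diag n d))" using j by (auto simp: diag_mat_def mat_diag_def)
  then have "poly (char_poly A) (d j) = 0"
    unfolding cp poly_prod_list_zero_iff by force
  then show ?thesis by (simp add: eigenvalue_root_char_poly[OF A])
qed

text \<open>A right inverse of a square matrix over a field is two-sided, and inverses are unique.
  This evaluates \<open>the (mat_inverse A)\<close> in \<open>mat_powi\<close>.\<close>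

lemma mat_inverse_eq_Some:
  fixes A :: "'a :: field mat"
  assumes A: "A \<in> carrier_mat n n" and B: "B \<in> carrier_mat n n" and AB: "A * B = 1\<^sub>m n"
  shows "mat_inverse A = Some B"
proof -
  have BA: "B * A = 1\<^sub>m n" by (rule mat_mult_left_right_inverse[OF A B AB])
  have "A \<in> Units (ring_mat TYPE('a) n ())"
    using A B AB BA by (auto simp: Units_def ring_mat_def)
  then obtain C where C: "mat_inverse A = Some C"
    using mat_inverse(1)[OF A, of "()"] by (cases "mat_inverse A") auto
  then have "A * C = 1\<^sub>m n" "C \<in> carrier_mat n n" using mat_inverse(2)[OF A] by auto
  then have "C = B" using assoc_mult_mat[OF B A, of C n] B BA by simp
  with C show ?thesis by simp
qed

lemma mat_powi_similar_diag:
  fixes A :: "'a :: field mat"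
  assumes A: "A \<in> carrier_mat n n" and wit: "similar_mat_wit A (mat_diag n d) P Q"
    and nz: "\<And>j. j < n \<Longrightarrow> d j \<noteq> 0"
  shows "mat_powi A i = P * mat_diag n (\<lambda>j. d j powi i) * Q"
proof -
  note w = similar_mat_witD2[OF A wit]
  \<comment> \<open>General in \<open>C\<close> and \<open>f\<close>, to serve both for
    \<open>A\<close> and for its inverse, the two cases of \<open>mat_powi\<close>.\<close>
  have pow: "C ^\<^sub>m k = P * mat_diag n (\<lambda>j. f j ^ k) * Q"
    if "C = P * mat_diag n f * Q" for C f k
    using similar_mat_wit_pow_id[of C "mat_diag n f" P Q k] w that
      similar_mat_witI[OF w(1,2) that, unfolded that]
    by (simp add: mat_diag_power)
  let ?B = "P * mat_diag n (\<lambda>j. inverse (d j)) * Q"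
  have "A * ?B = P * mat_diag n (\<lambda>j. d j * inverse (d j)) * Q"
    unfolding w(3) by (rule similar_diag_mult[OF w(6,7,2)])
  also have "mat_diag n (\<lambda>j. d j * inverse (d j)) = mat_diag n (\<lambda>j. 1)"
    by (rule mat_diag_cong) (simp add: nz)
  also have "P * \<dots> * Q = 1\<^sub>m n" using w by simp
  finally have "mat_inverse A = Some ?B"
    using A w by (intro mat_inverse_eq_Some[of A n]) auto
  then show ?thesis
    by (simp add: mat_powi_def power_int_def pow[OF w(3)] pow[OF refl])
qed

section \<open>Multiplication of block matrices\<close>

lemma sum_div_mod:
  fixes g :: "nat \<Rightarrow> nat \<Rightarrow> 'a :: comm_monoid_add"
  assumes "m > 0"
  shows "(\<Sum>z<n * m. g (z div m) (z mod m)) = (\<Sum>c<n. \<Sum>u<m. g c u)"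
proof -
  have "(\<Sum>z<n * m. g (z div m) (z mod m)) = (\<Sum>c<n. \<Sum>z=c*m..<c*m+m. g (z div m) (z mod m))"
    by (rule sum.nat_group[symmetric])
  also have "\<dots> = (\<Sum>c<n. \<Sum>u<m. g c u)"
  proof (rule sum.cong[OF refl])
    fix c
    have "(\<Sum>z=c*m..<c*m+m. g (z div m) (z mod m))
        = (\<Sum>u=0..<m. g ((u + c*m) div m) ((u + c*m) mod m))"
      by (subst sum.shift_bounds_nat_ivl[symmetric]) (simp add: add.commute)
    also have "\<dots> = (\<Sum>u<m. g c u)"
      using assms by (auto simp: atLeast0LessThan intro!: sum.cong)
    finally show "(\<Sum>z=c*m..<c*m+m. g (z div m) (z mod m)) = (\<Sum>u<m. g c u)" .
  qed
  finally show ?thesis .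
qed

lemma block_subst_carrier:
  "H \<in> carrier_mat p q \<Longrightarrow> block_subst m f H \<in> carrier_mat (p * m) (q * m)"
  by (auto simp: block_subst_def)

text \<open>The summation index splits into a block number (\<open>div m\<close>) and a position
  inside the block (\<open>mod m\<close>); the inner sum is then a product of two blocks.\<close>

lemma block_subst_mult_adjoint:
  assumes H: "H \<in> carrier_mat p q"
    and f: "\<And>a c. a < p \<Longrightarrow> c < q \<Longrightarrow> f (H $$ (a, c)) \<in> carrier_mat m m"
    and x: "x < p * m" and y: "y < p * m"
  shows "(block_subst m f H * mat_adjoint (block_subst m f H)) $$ (x, y)
    = (\<Sum>c<q. (f (H $$ (x div m, c)) * mat_adjoint (f (H $$ (y div m, c)))) $$ (x mod m, y mod m))"
proof -
  have m: "m > 0" using x by (cases m) auto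
  have div: "x div m < p" "y div m < p"
    using x y by (simp_all add: less_mult_imp_div_less)
  let ?g = "\<lambda>c u. f (H $$ (x div m, c)) $$ (x mod m, u)
    * cnj (f (H $$ (y div m, c)) $$ (y mod m, u))"
  have "(block_subst m f H * mat_adjoint (block_subst m f H)) $$ (x, y)
      = (\<Sum>z<q * m. ?g (z div m) (z mod m))"
    using H x y by (auto simp: block_subst_def scalar_prod_def atLeast0LessThan intro!: sum.cong)
  also have "\<dots> = (\<Sum>c<q. \<Sum>u<m. ?g c u)" by (rule sum_div_mod[OF m])
  also have "\<dots> = (\<Sum>c<q. (f (H $$ (x div m, c)) * mat_adjoint (f (H $$ (y div m, c))))
      $$ (x mod m, y mod m))"
  proof (rule sum.cong[OF refl])
    fix c assume "c \<in> {..<q}"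
    then have "f (H $$ (x div m, c)) \<in> carrier_mat m m" "f (H $$ (y div m, c)) \<in> carrier_mat m m"
      using f div by auto
    then show "(\<Sum>u<m. ?g c u) = (f (H $$ (x div m, c)) * mat_adjoint (f (H $$ (y div m, c))))
      $$ (x mod m, y mod m)"
      using m by (auto simp: scalar_prod_def atLeast0LessThan intro!: sum.cong)
  qed
  finally show ?thesis .
qed

section \<open>Roots of unity and adjoints of Butson matrices\<close>

lemma zeta_nonzero: "\<zeta> k \<noteq> 0"
  by (simp add: \<zeta>_def)

text \<open>\<open>\<zeta> k\<close> lies on the unit circle, even for \<open>k = 0\<close>, where
  division by zero makes it 1.\<close>

lemma cnj_zeta: "cnj (\<zeta> k) = inverse (\<zeta> k)"
proof -
  have "\<zeta> k = cis (2 * pi / real k)" by (simp add: \<zeta>_def cis_conv_exp mult_ac)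
  then show ?thesis by (simp add: cis_cnj)
qed

lemma ButD:
  assumes "H \<in> But n k"
  shows "H \<in> carrier_mat n n" "H * mat_adjoint H = of_nat n \<cdot>\<^sub>m 1\<^sub>m n"
    "i < n \<Longrightarrow> j < n \<Longrightarrow> H $$ (i, j) \<in> G k"
  using assms elements_matI[of H n n i j] by (auto simp: But_def)

text \<open>For \<open>n > 0\<close> the adjoint divided by \<open>n\<close> is a right inverse of
  the square matrix \<open>H\<close>, hence a left inverse. In particular \<open>H\<close> is
  normal.\<close>

lemma But_adjoint_mult:
  assumes "H \<in> But n k"
  shows "mat_adjoint H * H = of_nat n \<cdot>\<^sub>m 1\<^sub>m n"
proof (cases "n = 0")
  case True
  then show ?thesis using ButD(1)[OF assms] by (intro eq_matI) auto
next
  case False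
  note H = ButD[OF assms]
  let ?c = "inverse (of_nat n) :: complex"
  have adj: "mat_adjoint H \<in> carrier_mat n n" using H(1) by simp
  have "H * (?c \<cdot>\<^sub>m mat_adjoint H) = 1\<^sub>m n"
    unfolding mult_smult_distrib[OF H(1) adj] H(2) using False by (intro eq_matI) auto
  from mat_mult_left_right_inverse[OF H(1) smult_carrier_mat[OF adj] this]
  have "?c \<cdot>\<^sub>m (mat_adjoint H * H) = 1\<^sub>m n"
    unfolding mult_smult_assoc_mat[OF adj H(1)] .
  then have "of_nat n \<cdot>\<^sub>m (?c \<cdot>\<^sub>m (mat_adjoint H * H)) = of_nat n \<cdot>\<^sub>m 1\<^sub>m n" by simp
  moreover have "of_nat n \<cdot>\<^sub>m (?c \<cdot>\<^sub>m (mat_adjoint H * H)) = mat_adjoint H * H"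
    using False by (intro eq_matI) (simp_all del: index_mult_mat(1))
  ultimately show ?thesis by simp
qed

text \<open>Multiplying \<open>H * B\<close> by the adjoint from the left cancels \<open>H\<close>.
  This identifies an adjoint through a product alone, without conjugating any factor of
  \<open>H\<close>.\<close>

lemma But_adjoint_eqI:
  assumes "H \<in> But n k" and B: "B \<in> carrier_mat n n" and HB: "H * B = of_nat n \<cdot>\<^sub>m 1\<^sub>m n"
  shows "mat_adjoint H = B"
proof -
  note H = ButD[OF assms(1)]
  have adj: "mat_adjoint H \<in> carrier_mat n n" using H(1) by simp
  have I: "(1\<^sub>m n :: complex mat) \<in> carrier_mat n n" by simp
  have "of_nat n \<cdot>\<^sub>m mat_adjoint H = mat_adjoint H * (H * B)"
    unfolding HB mult_smult_distrib[OF adj I] right_mult_one_mat[OF adj] ..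
  also have "\<dots> = (mat_adjoint H * H) * B" by (rule assoc_mult_mat[OF adj H(1) B, symmetric])
  also have "\<dots> = of_nat n \<cdot>\<^sub>m B"
    unfolding But_adjoint_mult[OF assms(1)] mult_smult_assoc_mat[OF I B] left_mult_one_mat[OF B] ..
  finally have eq: "of_nat n \<cdot>\<^sub>m mat_adjoint H = of_nat n \<cdot>\<^sub>m B" .
  have "mat_adjoint H $$ (i, j) = B $$ (i, j)" if "i < n" "j < n" for i j
    using arg_cong[OF eq, of "\<lambda>A. A $$ (i, j)"] that adj B H(1) by simp
  then show ?thesis using adj B by (intro eq_matI) auto
qed

text \<open>The first conjunct shows that the exponent chosen in \<open>phi\<close> does not matter,
  so that the second one is about the intended map.\<close>

theorem theorem2p3:
  fixes k l m n :: nat and H M :: "complex mat"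
  assumes "k > 0" and "l > 0" and "m > 0" and "n > 0"
    and "H \<in> But n k" and "M \<in> But m l"
    and "sound n k m l H M"
  shows "(\<forall>i :: int. phi k m M (\<zeta> k powi i) = scaled_power m M i) \<and>
         block_subst m (phi k m M) H \<in> But (m * n) l"
proof -
  define s where "s = complex_of_real (sqrt (real m))"
  have s: "s \<noteq> 0" "s * s = of_nat m"
    using \<open>m > 0\<close> by (simp_all add: s_def flip: of_real_mult)
  obtain X Y where HX: "elements_mat H \<subseteq> X" and Y: "Y \<subseteq> G k"
    and ev: "\<And>e. eigenvalue (inverse s \<cdot>\<^sub>m M) e \<Longrightarrow> e \<in> Y"
    and SX: "\<And>i. \<zeta> k powi i \<in> X \<Longrightarrow> scaled_power m M i \<in> But m l"
    and HY: "\<And>j. \<zeta> k powi j \<in> Y \<Longrightarrow> entrywise_power H j \<in> But n k"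
    using \<open>sound n k m l H M\<close> unfolding sound_def XY_sound_def s_def by blast
  note H = ButD[OF \<open>H \<in> But n k\<close>]
  note M = ButD[OF \<open>M \<in> But m l\<close>]
  obtain d P Q where wit: "similar_mat_wit M (mat_diag m d) P Q"
    using normal_similar_mat_diag[OF M(1)] M(2) But_adjoint_mult[OF \<open>M \<in> But m l\<close>] by metis
  note w = similar_mat_witD2[OF M(1) wit]
  \<comment> \<open>Scaling \<open>M\<close> keeps \<open>P\<close> and \<open>Q\<close>, so the
    numbers \<open>d r / s\<close> are eigenvalues of the scaled matrix and lie in
    \<open>Y\<close>.\<close>
  have "similar_mat_wit (inverse s \<cdot>\<^sub>m M) (mat_diag m (\<lambda>r. inverse s * d r)) P Q"
    using similar_mat_wit_smult[OF wit] unfolding smult_mat_diag .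
  then have lam_Y: "d r / s \<in> Y" if "r < m" for r
    using ev[OF eigenvalue_similar_diag[OF smult_carrier_mat[OF M(1)] _ that]]
    by (simp add: divide_inverse mult.commute)
  then have "\<forall>r. r < m \<longrightarrow> (\<exists>e. d r / s = \<zeta> k powi e)"
    using Y by (auto simp: G_def)
  then obtain e where e: "\<And>r. r < m \<Longrightarrow> d r / s = \<zeta> k powi e r" by metis
  define z where "z r = \<zeta> k powi e r" for r
  have z_nz: "z r \<noteq> 0" for r by (simp add: z_def zeta_nonzero)
  have d: "d r = s * z r" if "r < m" for r
    using e[OF that] s by (simp add: z_def field_simps)
  \<comment> \<open>The power \<open>1 - i\<close> of \<open>s\<close> absorbs the factor
    \<open>s powi i\<close> coming from \<open>d r = s * z r\<close> and leaves a single
    \<open>s\<close>.\<close>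
  have S: "scaled_power m M i = P * mat_diag m (\<lambda>r. s * z r powi i) * Q" for i
  proof -
    have "scaled_power m M i = s powi (1 - i) \<cdot>\<^sub>m (P * mat_diag m (\<lambda>r. d r powi i) * Q)"
      unfolding scaled_power_def s_def
      using mat_powi_similar_diag[OF M(1) wit] d s z_nz by simp
    also have "\<dots> = P * mat_diag m (\<lambda>r. s powi (1 - i) * d r powi i) * Q"
      by (rule similar_diag_smult[OF w(6,7)])
    also have "mat_diag m (\<lambda>r. s powi (1 - i) * d r powi i) = mat_diag m (\<lambda>r. s * z r powi i)"
      using s by (intro mat_diag_cong) (simp add: d power_int_diff power_int_mult_distrib)
    finally show ?thesis .
  qed
  \<comment> \<open>Exchanging the two exponents has two uses: the power depends on
    \<open>\<zeta> k powi i\<close> only, and powers of the eigenvalue \<open>z r\<close> turn into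
    \<open>e r\<close>-th powers of entries of \<open>H\<close>.\<close>
  have z_powi: "z r powi i = (\<zeta> k powi i) powi e r" for r i
    by (simp add: z_def mult.commute flip: power_int_mult)
  have phi: "phi k m M (\<zeta> k powi i) = scaled_power m M i" for i
  proof -
    have "\<zeta> k powi i = \<zeta> k powi (SOME j. \<zeta> k powi i = \<zeta> k powi j)"
      by (rule someI[of "\<lambda>j. \<zeta> k powi i = \<zeta> k powi j"]) simp
    then show ?thesis unfolding phi_def S z_powi by simp
  qed
  have "\<forall>a c. a < n \<longrightarrow> c < n \<longrightarrow> (\<exists>i. H $$ (a, c) = \<zeta> k powi i)"
    using H(3) by (auto simp: G_def)
  then obtain E where E: "\<And>a c. a < n \<Longrightarrow> c < n \<Longrightarrow> H $$ (a, c) = \<zeta> k powi E a c" by metis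
  have phi_H: "phi k m M (H $$ (a, c)) = scaled_power m M (E a c)" if "a < n" "c < n" for a c
    using E[OF that] phi by simp
  have But_S: "scaled_power m M (E a c) \<in> But m l" if "a < n" "c < n" for a c
    using SX HX elements_matI[OF H(1) that refl] E[OF that] by auto
  \<comment> \<open>\<open>P\<close> is not known to be unitary, so the adjoint cannot be read off
    from the factors. Instead condition (1) places the block in \<open>But m l\<close>, and its
    product with the claimed adjoint is checked.\<close>
  have adj_S: "mat_adjoint (scaled_power m M (E a c))
      = P * mat_diag m (\<lambda>r. s * z r powi (- E a c)) * Q"
    if "a < n" "c < n" for a c
  proof (rule But_adjoint_eqI[OF But_S[OF that]])
    show "P * mat_diag m (\<lambda>r. s * z r powi (- E a c)) * Q \<in> carrier_mat m m"
      by (intro mult_carrier_mat[of _ m m] w mat_diag_dim)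
    have "scaled_power m M (E a c) * (P * mat_diag m (\<lambda>r. s * z r powi (- E a c)) * Q)
        = P * mat_diag m (\<lambda>r. (s * z r powi E a c) * (s * z r powi (- E a c))) * Q"
      unfolding S by (rule similar_diag_mult[OF w(6,7,2)])
    also have "mat_diag m (\<lambda>r. (s * z r powi E a c) * (s * z r powi (- E a c)))
        = mat_diag m (\<lambda>r. of_nat m)"
      using s z_nz by (intro mat_diag_cong) (simp add: power_int_minus field_simps)
    finally show "scaled_power m M (E a c) * (P * mat_diag m (\<lambda>r. s * z r powi (- E a c)) * Q)
        = of_nat m \<cdot>\<^sub>m 1\<^sub>m m"
      using similar_diag_const[OF w(6,7,1)] by simp
  qed
  \<comment> \<open>By \<open>z_powi\<close> the summands are products of entries of
    \<open>?K\<close> with conjugates of entries of \<open>?K\<close>, since conjugation inverts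
    powers of \<open>\<zeta> k\<close>. Condition (2) applies because \<open>z r\<close> lies in
    \<open>Y\<close>.\<close>
  have orth: "(\<Sum>c<n. z r powi E a c * z r powi (- E b c)) = (if a = b then of_nat n else 0)"
    if "a < n" "b < n" "r < m" for a b r
  proof -
    let ?K = "entrywise_power H (e r)"
    have K: "?K \<in> But n k" using HY lam_Y[OF \<open>r < m\<close>] e[OF \<open>r < m\<close>] by simp
    have "(\<Sum>c<n. z r powi E a c * z r powi (- E b c)) = (?K * mat_adjoint ?K) $$ (a, b)"
      using H(1) that
      by (simp add: entrywise_power_def scalar_prod_def atLeast0LessThan E z_powi power_int_minus
          cnj_zeta power_int_inverse)
    also have "\<dots> = (if a = b then of_nat n else 0)"
      using ButD(2)[OF K] that by simp
    finally show ?thesis .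
  qed
  let ?B = "block_subst m (phi k m M) H"
  have B: "?B \<in> carrier_mat (n * m) (n * m)" by (rule block_subst_carrier[OF H(1)])
  have "?B \<in> But (m * n) l"
    unfolding But_def mem_Collect_eq
  proof (intro conjI subsetI)
    show "?B \<in> carrier_mat (m * n) (m * n)" using B by (simp add: mult.commute)
    \<comment> \<open>Every entry lies in some block, and the blocks belong to
      \<open>But m l\<close> by condition (1).\<close>
    fix x assume "x \<in> elements_mat ?B"
    then obtain i j where ij: "i < n * m" "j < n * m" and x: "x = ?B $$ (i, j)"
      using B by auto
    have "i div m < n" "j div m < n"
      using ij by (simp_all add: less_mult_imp_div_less)
    moreover from this have "x = scaled_power m M (E (i div m) (j div m)) $$ (i mod m, j mod m)"
      unfolding x using H(1) ij by (simp add: block_subst_def phi_H)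
    ultimately show "x \<in> G l" using ButD(3)[OF But_S] \<open>m > 0\<close> by simp
  next
    have "(?B * mat_adjoint ?B) $$ (x, y) = (of_nat (m * n) \<cdot>\<^sub>m 1\<^sub>m (m * n)) $$ (x, y)"
      if x: "x < n * m" and y: "y < n * m" for x y
    proof -
      define a b u v where "a = x div m" and "b = y div m" and "u = x mod m" and "v = y mod m"
      note defs = a_def b_def u_def v_def
      have ab: "a < n" "b < n" using x y by (simp_all add: defs less_mult_imp_div_less)
      have uv: "u < m" "v < m" using \<open>m > 0\<close> by (simp_all add: defs)
      have eq: "x = y \<longleftrightarrow> a = b \<and> u = v" unfolding defs by (metis div_mult_mod_eq)
      have "(?B * mat_adjoint ?B) $$ (x, y)
          = (\<Sum>c<n. (scaled_power m M (E a c) * mat_adjoint (scaled_power m M (E b c))) $$ (u, v))"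
        using block_subst_mult_adjoint[OF H(1) _ x y, of "phi k m M"] ab ButD(1)[OF But_S]
        by (simp add: phi_H flip: defs)
      also have "\<dots> = (\<Sum>c<n. \<Sum>r<m.
          P $$ (u, r) * ((s * z r powi E a c) * (s * z r powi (- E b c))) * Q $$ (r, v))"
        by (intro sum.cong refl)
          (simp only: lessThan_iff adj_S[OF ab(2)] S[of "E a _"] similar_diag_mult[OF w(6,7,2)]
            similar_diag_index[OF w(6,7) uv])
      \<comment> \<open>With \<open>r\<close> outermost, the sum over \<open>c\<close> concerns a
        single eigenvalue, as \<open>orth\<close> requires; the two factors \<open>s\<close> give
        \<open>of_nat m\<close>.\<close>
      also have "\<dots> = (\<Sum>r<m. \<Sum>c<n.
          P $$ (u, r) * ((s * z r powi E a c) * (s * z r powi (- E b c))) * Q $$ (r, v))"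
        by (rule sum.swap)
      also have "\<dots> = (\<Sum>r<m.
          P $$ (u, r) * (of_nat m * (\<Sum>c<n. z r powi E a c * z r powi (- E b c))) * Q $$ (r, v))"
        by (simp add: sum_distrib_left sum_distrib_right mult_ac flip: s(2))
      also have "\<dots> = (\<Sum>r<m.
          P $$ (u, r) * (of_nat m * (if a = b then of_nat n else 0)) * Q $$ (r, v))"
        using ab by (intro sum.cong refl) (simp only: lessThan_iff orth)
      also have "\<dots> = (P * mat_diag m (\<lambda>r. of_nat m * (if a = b then of_nat n else 0)) * Q) $$ (u, v)"
        by (rule similar_diag_index[OF w(6,7) uv, symmetric])
      \<comment> \<open>The diagonal is now constant, so \<open>P\<close> and \<open>Q\<close>
        cancel: diagonal blocks are \<open>m * n\<close> times the identity, the others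
        vanish.\<close>
      also have "\<dots> = (of_nat (m * n) \<cdot>\<^sub>m 1\<^sub>m (m * n)) $$ (x, y)"
        unfolding similar_diag_const[OF w(6,7,1)]
        using x y uv eq by (simp add: mult.commute[of m n])
      finally show ?thesis .
    qed
    then show "?B * mat_adjoint ?B = of_nat (m * n) \<cdot>\<^sub>m 1\<^sub>m (m * n)"
      using B by (intro eq_matI) (auto simp: mult.commute)
  qed
  with phi show ?thesis by blast
qed

end
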